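(* Let $p$ be a prime and let $(\theta_i)_{i=1}^r$ and $(\sigma_j)_{j=1}^{s-1}$ be sequences of $p$-integral rational numbers from the interval $(0,1]$ with $r\le s$. Suppose that for all $k\in\mathbb N$ the sequence $(\theta_i^{(k)})_{i=1}^r$ is dominated by the sequence $(\sigma_j^{(k)})_{j=1}^{s-1}$. Then the hypergeometric series $${}_rF_{s-1}\bigg(\begin{matrix}\theta_1&\dots&\theta_r\\ \sigma_1&\dots&\sigma_{s-1}\end{matrix}\,\bigg|\,\pi^{s-r}t\bigg)=\sum_{j=0}^\infty\frac{(\theta_1)_j\cdots(\theta_r)_j\,\pi^{(s-r)j}}{j!\,(\sigma_1)_j\cdots(\sigma_{s-1})_j}\,t^j$$ has $p$-integral coefficients.
   Context: $\mathbb N$ = nonnegative integers. $(\alpha)_j=\alpha(\alpha+1)\cdots(\alpha+j-1)$. $\pi$ is a fixed element (of an algebraic closure of $\mathbb Q_p$) with $\pi^{p-1}=-p$. "$p$-integral" means of nonnegative $p$-adic valuation. The operation $\alpha\mapsto\alpha^{(k)}$: for $t=t_0+t_1p+\cdots+t_{a-1}p^{a-1}$ ($0\le t_j\le p-1$, $a$ fixed) put $t'=t_1+t_2p+\cdots+t_{a-1}p^{a-2}+t_0p^{a-1}$ and let $t^{(k)}$ be the $k$-fold iterate. For a $p$-integral rational number $\alpha$ with $0\le\alpha\le1$ choose a positive integer $a$ with $t=(p^a-1)\alpha\in\mathbb N$, and put $\alpha^{(k)}=t^{(k)}/(p^a-1)$ (independent of the choice of $a$). Domination: let $(\theta_i)_{i=1}^r$,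 $(\sigma_j)_{j=1}^{s-1}$, $s\ge r$, be sequences of real numbers in $(0,1]$ (the order of the terms within each sequence is irrelevant; they are reordered as follows). - If $s=r$: set $\sigma_r=1$ and order so that $\theta_1\le\dots\le\theta_r$ and $\sigma_1\le\dots\le\sigma_r$. Then $(\theta_i)$ is dominated by $(\sigma_j)$ if $\theta_k<\sigma_k$ for $k=1,\dots,r$. - If $s=r+1$: order both sequences to be nondecreasing. Then $(\theta_i)$ is dominated by $(\sigma_j)$ if $\theta_k<\sigma_k$ for $k=1,\dots,s-1$. - If $s>r+1$: combine $(\theta_i)_{i=1}^r$ and $(i/(s-r))_{i=1}^{s-r-1}$ into one nondecreasing sequence $(\tilde\theta_i)_{i=1}^{s-1}$. Let $i_k$ be the position in it of the term coming from $k/(s-r)$, $k=1,\dots,s-r-1$, the ordering being chosen so that $\tilde\theta_{i_k}>\tilde\theta_{i_k-1}$ for all $k$ (unless $i_k=1$), i.e. in case of equality the term $k/(s-r)$ is listed before equal terms coming from the $\theta_i$. Order the $\sigma_j$ nondecreasingly. Then $(\theta_i)$ is dominated by $(\sigma_j)$ if $\tilde\theta_l<\sigma_l$ for $l\in\{1,\dots,s-1\}\setminus\{i_1,\dots,i_{s-r-1}\}$ and $\tilde\theta_{i_k}\le\sigma_{i_k}$ for $k=1,\dots,s-r-1$. *)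

theory Defs
  imports
    Complex_Main
    "HOL-Library.Extended_Real"
    "HOL-Computational_Algebra.Computational_Algebra"
begin

text \<open>
  A field \<^typ>\<open>'a\<close> with a valuation \<^term>\<open>v\<close> that is an algebraic closure of the field of
  \<open>p\<close>-adic numbers with the extended \<open>p\<close>-adic valuation: the completion of the rationals inside
  \<^typ>\<open>'a\<close>, i.e. the set \<open>Qp v\<close> of limits of rationals, is complete (hence is the field of
  \<open>p\<close>-adic numbers), and \<^typ>\<open>'a\<close> is algebraically closed and algebraic over it.  The
  normalisation \<open>v p = 1\<close> forces \<open>v\<close> to restrict to the \<open>p\<close>-adic valuation on the rationals.
\<close>

definition Qp :: "('a::field_char_0 \<Rightarrow> ereal) \<Rightarrow> 'a set" where
  "Qp v = {x. \<forall>C::real. \<exists>q::rat. v (x - of_rat q) > ereal C}"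

locale padic_algebraic_closure =
  fixes p :: nat and v :: "'a::{alg_closed_field, field_char_0} \<Rightarrow> ereal"
  assumes prime_p: "prime p"
    and val_eq_infinity_iff: "v x = \<infinity> \<longleftrightarrow> x = 0"
    and val_mult: "v (x * y) = v x + v y"
    and val_add: "v (x + y) \<ge> min (v x) (v y)"
    and val_p: "v (of_nat p) = 1"
    \<comment> \<open>Completeness of \<^term>\<open>Qp v\<close>; since the rationals are dense in it, Cauchy sequences of
      rationals suffice.\<close>
    and complete:
      "(\<forall>C::real. \<exists>N::nat. \<forall>m\<ge>N. \<forall>n\<ge>N. v (of_rat (X m) - of_rat (X n)) > ereal C) \<Longrightarrow>
        \<exists>x. \<forall>C::real. \<exists>N::nat. \<forall>n\<ge>N. v (x - of_rat (X n)) > ereal C"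
    and algebraic:
      "\<exists>f. f \<noteq> 0 \<and> (\<forall>i. coeff f i \<in> Qp v) \<and> poly f x = 0"

definition p_integral :: "('a::field \<Rightarrow> ereal) \<Rightarrow> 'a \<Rightarrow> bool" where
  "p_integral v x \<longleftrightarrow> 0 \<le> v x"

definition digit :: "nat \<Rightarrow> nat \<Rightarrow> nat \<Rightarrow> nat" where
  "digit p t j = t div p ^ j mod p"

definition digit_shift :: "nat \<Rightarrow> nat \<Rightarrow> nat \<Rightarrow> nat" where
  "digit_shift p a t = (\<Sum>j<a - 1. digit p t (Suc j) * p ^ j) + digit p t 0 * p ^ (a - 1)"

text \<open>
  \<open>frac_shift p k \<alpha>\<close> is \<open>\<alpha>^(k)\<close>, meant for \<open>p\<close>-integral rationals \<open>0 \<le> \<alpha> \<le> 1\<close>.  It does not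
  depend on the choice of \<open>a\<close>; the least one is used.
\<close>

definition frac_shift :: "nat \<Rightarrow> nat \<Rightarrow> rat \<Rightarrow> rat" where
  "frac_shift p k \<alpha> =
    (let a = (LEAST a. 0 < a \<and> (of_nat p ^ a - 1) * \<alpha> \<in> \<nat>);
         t = nat \<lfloor>(of_nat p ^ a - 1) * \<alpha>\<rfloor>
     in of_nat ((digit_shift p a ^^ k) t) / (of_nat p ^ a - 1))"

text \<open>
  The sequence \<open>\<theta>\<close> with the terms \<open>i/d\<close>, \<open>0 < i < d\<close>, merged in, in nondecreasing order; the
  latter are the entries tagged \<^const>\<open>True\<close>.  As \<^const>\<open>sort_key\<close> is stable, they are listed
  before equal terms coming from \<open>\<theta>\<close>.
\<close>

definition merged :: "nat \<Rightarrow> real list \<Rightarrow> (real \<times> bool) list" where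
  "merged d \<theta> =
    sort_key fst (map (\<lambda>i. (real i / real d, True)) [1..<d] @ map (\<lambda>x. (x, False)) \<theta>)"

text \<open>Lists are indexed from \<open>0\<close>, and \<open>\<sigma>\<close> has \<open>s - 1\<close> terms.\<close>

definition dominated :: "real list \<Rightarrow> real list \<Rightarrow> bool" where
  "dominated \<theta> \<sigma> \<longleftrightarrow>
    (let r = length \<theta>; s = length \<sigma> + 1 in
      if s = r then \<forall>k<r. sort \<theta> ! k < sort (\<sigma> @ [1]) ! k
      else if s = r + 1 then \<forall>k<s - 1. sort \<theta> ! k < sort \<sigma> ! k
      else if s > r + 1 then
        \<forall>l<s - 1. let (x, tagged) = merged (s - r) \<theta> ! l in
          (if tagged then x \<le> sort \<sigma> ! l else x < sort \<sigma> ! l)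
      else False)"

end

theory Submission
  imports Defs "HOL-Number_Theory.Residues"
begin

text \<open>
  For a \<open>p\<close>-integral \<open>\<alpha>\<close> in \<open>(0,1]\<close>, \<open>p^k \<alpha>^(k) - \<alpha>\<close> is the residue \<open>R\<close> of \<open>-\<alpha>\<close> modulo \<open>p^k\<close>.
  Counting the \<open>i < j\<close> with \<open>i \<equiv> R\<close> modulo \<open>p^k\<close> shows that \<open>(\<alpha>)_j\<close> has valuation
  \<open>\<Sum>k\<ge>1. (\<lfloor>j/p^k\<rfloor> + [\<alpha>^(k) \<le> x_k])\<close>, where \<open>x_k\<close> is the fractional part of \<open>j/p^k\<close>.
  Since \<open>\<pi>^j\<close> has valuation \<open>j/(p-1) = \<Sum>k\<ge>1. j/p^k\<close>, the \<open>j\<close>-th coefficient has valuation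
  \<open>\<Sum>k\<ge>1. ((s-r) x_k + #{i. \<theta>_i^(k) \<le> x_k} - #{i. \<sigma>_i^(k) \<le> x_k})\<close>, and domination makes every
  summand nonnegative, because at most \<open>(s-r) x_k\<close> of the merged fractions \<open>i/(s-r)\<close> are \<open>\<le> x_k\<close>.
  All sums are truncated at a large \<open>K\<close>, which only decreases the contribution of \<open>\<pi>\<close>.
\<close>

section \<open>Digit rotation and residues of -\<alpha> modulo powers of p\<close>

lemma sum_digits: "(\<Sum>j<n. digit p u j * p ^ j) = u mod p ^ n"
proof (induction n)
  case (Suc n)
  have "u mod p ^ Suc n = p ^ n * (u div p ^ n mod p) + u mod p ^ n"
    by (metis mod_mult2_eq mult.commute power_Suc)
  with Suc show ?case by (simp add: digit_def algebra_simps)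
qed simp

text \<open>Rotation is division by p modulo p^a - 1: writing t = p q + t_0, it yields q + t_0
  p^(a-1), and p times this is p q + t_0 p^a.\<close>

lemma mult_digit_shift:
  assumes "0 < a" and "t < p ^ a"
  shows "p * digit_shift p a t = t + (t mod p) * (p ^ a - 1)"
proof -
  obtain n where a: "a = Suc n" using \<open>0 < a\<close> gr0_implies_Suc by blast
  have "t div p < p ^ n"
    using assms(2) by (simp add: a less_mult_imp_div_less mult.commute)
  then have "(\<Sum>j<n. digit p t (Suc j) * p ^ j) = t div p"
    using sum_digits[of p "t div p" n] by (simp add: digit_def div_mult2_eq)
  then have "p * digit_shift p a t = p * (t div p) + (t mod p) * p ^ a"
    by (simp add: digit_shift_def digit_def a algebra_simps)
  moreover have "p * (t div p) + t mod p = t" by simp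
  moreover have "t mod p * p ^ a = t mod p + (t mod p) * (p ^ a - 1)"
  proof -
    have "p ^ a = 1 + (p ^ a - 1)" using assms(2) by simp
    then show ?thesis by (metis distrib_left mult.right_neutral)
  qed
  ultimately show ?thesis by linarith
qed

text \<open>\<open>R\<close> collects the lowest digits of the successive iterates as its own base p
  digits, whence \<open>R < p ^ k\<close>. The bound on the iterate is carried along because
  \<open>mult_digit_shift\<close> needs it at every step.\<close>

lemma funpow_digit_shift:
  assumes "0 < a" and "0 < p" and "t < p ^ a"
  shows "(digit_shift p a ^^ k) t < p ^ a \<and>
    (\<exists>R<p ^ k. p ^ k * (digit_shift p a ^^ k) t = t + (p ^ a - 1) * R)"
proof (induction k)
  case 0
  then show ?case using assms(3) by auto
next
  case (Suc k)
  define u where "u = (digit_shift p a ^^ k) t"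
  define D where "D = p ^ a - 1"
  obtain R where R: "R < p ^ k" "p ^ k * u = t + D * R" and u: "u < p ^ a"
    using Suc unfolding u_def D_def by auto
  have step: "p * digit_shift p a u = u + (u mod p) * D"
    unfolding D_def by (rule mult_digit_shift[OF assms(1) u])
  have up: "u mod p \<le> p - 1" using mod_less_divisor[OF assms(2), of u] by linarith
  \<comment> \<open>The bound is proved after multiplication by p, where the rotation has a closed
    form.\<close>
  have "p * digit_shift p a u \<le> D + (p - 1) * D"
    unfolding step using u up by (intro add_mono mult_right_mono) (auto simp: D_def)
  also have "\<dots> = p * D" using assms(2) by (cases p) auto
  finally have "digit_shift p a u \<le> D" using assms(2) by simp
  then have less: "digit_shift p a u < p ^ a" using assms(3) by (simp add: D_def)
  have "R + p ^ k * (u mod p) < p ^ k + p ^ k * (p - 1)"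
    using R(1) up by (intro add_less_le_mono mult_left_mono) auto
  also have "\<dots> = p ^ Suc k" using assms(2) by (cases p) auto
  finally have "R + p ^ k * (u mod p) < p ^ Suc k" .
  moreover have "p ^ Suc k * digit_shift p a u = t + D * (R + p ^ k * (u mod p))"
  proof -
    have "p ^ Suc k * digit_shift p a u = p ^ k * (p * digit_shift p a u)" by simp
    also have "\<dots> = p ^ k * u + p ^ k * ((u mod p) * D)" by (simp only: step distrib_left)
    finally show ?thesis using R(2) by (simp add: algebra_simps)
  qed
  ultimately show ?case using less unfolding u_def D_def by auto
qed

text \<open>Dividing p^k t^(k) = t + D R by D = p^a - 1 gives p^k \<alpha>^(k) = \<alpha> + R.
  Keeping \<open>D\<close> and \<open>t\<close> explicit states the congruence R = -\<alpha> modulo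
  p^k as a divisibility of natural numbers.\<close>

lemma frac_shift_residue:
  assumes "2 \<le> p" and "0 < \<alpha>" and "\<alpha> \<le> 1"
    and ex: "\<exists>a>0. (of_nat p ^ a - 1) * \<alpha> \<in> \<nat>"
  obtains D t where "coprime D p" and "0 < t" and "of_nat D * \<alpha> = of_nat t"
    and "\<And>k. \<exists>R<p ^ k. of_nat p ^ k * frac_shift p k \<alpha> = \<alpha> + of_nat R \<and> p ^ k dvd t + D * R"
proof -
  define a where "a = (LEAST a. 0 < a \<and> (of_nat p ^ a - 1) * \<alpha> \<in> \<nat>)"
  have a: "0 < a" "(of_nat p ^ a - 1) * \<alpha> \<in> \<nat>"
    using LeastI_ex[OF ex] unfolding a_def by auto
  then obtain t where t: "(of_nat p ^ a - 1) * \<alpha> = of_nat t" by (auto elim: Nats_cases)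
  define D where "D = p ^ a - 1"
  have pa: "1 < p ^ a" using assms(1) a(1) by (intro one_less_power) auto
  then have D: "of_nat D = (of_nat p ^ a - 1 :: rat)" "0 < D"
    by (simp_all add: D_def of_nat_diff)
  have Dt: "of_nat D * \<alpha> = of_nat t" using t D by simp
  have "0 < t"
  proof -
    have "(0::rat) < of_nat D * \<alpha>" using D(2) assms(2) by simp
    then show ?thesis using Dt by simp
  qed
  \<comment> \<open>The extreme case \<alpha> = 1 gives t = p^a - 1, which still has only
    \<open>a\<close> digits.\<close>
  have "(of_nat t :: rat) \<le> of_nat D"
    unfolding Dt[symmetric] using assms(2,3) by (simp add: mult_left_le)
  then have "t \<le> D" by (simp only: of_nat_le_iff)
  then have "t < p ^ a" using pa by (simp add: D_def)
  have shift: "frac_shift p k \<alpha> = of_nat ((digit_shift p a ^^ k) t) / of_nat D" for k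
    unfolding frac_shift_def a_def[symmetric] Let_def t D by simp
  show thesis
  proof
    have "coprime (p ^ a - 1) (p ^ a)" using pa by (intro coprime_diff_one_left_nat) linarith
    then show "coprime D p" using a(1) by (simp add: D_def)
  next
    fix k
    obtain R where R: "R < p ^ k" "p ^ k * (digit_shift p a ^^ k) t = t + D * R"
      using funpow_digit_shift[OF a(1) _ \<open>t < p ^ a\<close>] assms(1) unfolding D_def by force
    have "of_nat p ^ k * (of_nat ((digit_shift p a ^^ k) t) :: rat) = of_nat t + of_nat D * of_nat R"
      using arg_cong[OF R(2), of "of_nat :: nat \<Rightarrow> rat"] by simp
    also have "\<dots> = of_nat D * (\<alpha> + of_nat R)" unfolding Dt[symmetric] by (simp add: algebra_simps)
    finally have "of_nat p ^ k * frac_shift p k \<alpha> = \<alpha> + of_nat R"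
      using D(2) by (simp add: shift field_simps)
    moreover have "p ^ k dvd t + D * R" using R(2) by (metis dvd_triv_left)
    ultimately show "\<exists>R<p ^ k. of_nat p ^ k * frac_shift p k \<alpha> = \<alpha> + of_nat R \<and> p ^ k dvd t + D * R"
      using R(1) by blast
  qed (use \<open>0 < t\<close> Dt in auto)
qed

section \<open>Domination as an inequality between counting functions\<close>

lemma sorted_nth_le_iff:
  fixes x :: "'a::linorder"
  assumes "sorted xs" and "i < length xs"
  shows "xs ! i \<le> x \<longleftrightarrow> i < length (filter (\<lambda>y. y \<le> x) xs)"
  using assms
proof (induction xs arbitrary: i)
  case (Cons a xs)
  have "filter (\<lambda>y. y \<le> x) xs = []" if "\<not> a \<le> x"
    using Cons.prems(1) that by (auto simp: filter_empty_conv)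
  then show ?case using Cons by (cases i) (auto simp: filter_empty_conv)
qed simp

text \<open>If only n entries of \<open>xs\<close> were at most \<open>x\<close> and
  \<open>ys\<close> had more, entry n of sorted \<open>ys\<close> (counting from 0) would be at most
  \<open>x\<close>. Then so would entry n of sorted \<open>xs\<close>, giving n + 1 such
  entries.\<close>

lemma length_filter_le_mono:
  fixes x :: "'a::linorder"
  assumes "\<And>i. i < length (filter (\<lambda>y. y \<le> x) ys) \<Longrightarrow> i < length xs \<and> sort xs ! i \<le> sort ys ! i"
  shows "length (filter (\<lambda>y. y \<le> x) ys) \<le> length (filter (\<lambda>y. y \<le> x) xs)"
proof (rule ccontr)
  let ?n = "length (filter (\<lambda>y. y \<le> x) xs)"
  have count: "length (filter (\<lambda>y. y \<le> x) (sort zs)) = length (filter (\<lambda>y. y \<le> x) zs)" for zs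
    by (metis filter_sort length_sort)
  assume "\<not> ?thesis"
  then have n: "?n < length (filter (\<lambda>y. y \<le> x) ys)" by simp
  then have "?n < length (sort ys)" by (metis length_filter_le length_sort less_le_trans)
  then have "sort ys ! ?n \<le> x" using sorted_nth_le_iff[of "sort ys" ?n x] n count by simp
  then have "sort xs ! ?n \<le> x" using assms[OF n] by auto
  then show False using sorted_nth_le_iff[of "sort xs" ?n x] assms[OF n] count by simp
qed

text \<open>The tags decide only which comparisons are strict. Counting uses weak comparisons, so it
  suffices to know the sorted values.\<close>

lemma map_fst_merged:
  "map fst (merged d \<theta>) = sort (map (\<lambda>i. real i / real d) [1..<d] @ \<theta>)"
  unfolding merged_def
  by (rule properties_for_sort[symmetric]) (simp_all add: multiset.map_comp comp_def)

text \<open>The condition i/d \<le> x means i \<le> d x, which leaves at most the floor of d x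
  indices.\<close>

lemma length_filter_fractions_le:
  assumes "0 \<le> x"
  shows "length (filter (\<lambda>y. y \<le> x) (map (\<lambda>i. real i / real d) [1..<d])) \<le> real d * x"
proof -
  have "length (filter (\<lambda>y. y \<le> x) (map (\<lambda>i. real i / real d) [1..<d]))
      = card {i \<in> {1..<d}. real i / real d \<le> x}"
    by (simp add: filter_map comp_def distinct_length_filter Int_def conj_commute)
  also have "\<dots> \<le> card {1..nat \<lfloor>real d * x\<rfloor>}"
    by (rule card_mono) (auto simp: field_simps le_nat_floor)
  finally show ?thesis using assms by (simp add: le_floor_iff le_nat_iff)
qed

text \<open>Termwise comparison of sorted sequences bounds the counts, and the merged fractions are
  paid for by the summand (s - r) x.\<close>

lemma dominated_count:
  assumes "dominated \<theta> \<sigma>" and "0 \<le> x" and "x < 1"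
  shows "real (length (filter (\<lambda>y. y \<le> x) \<sigma>))
    \<le> real (length (filter (\<lambda>y. y \<le> x) \<theta>)) + (real (length \<sigma> + 1) - real (length \<theta>)) * x"
proof -
  let ?r = "length \<theta>" and ?s = "length \<sigma> + 1"
  consider "?s = ?r" | "?s = ?r + 1" | "?s > ?r + 1"
    using assms(1) unfolding dominated_def Let_def by (auto split: if_splits)
  then show ?thesis
  proof cases
    case 1
    \<comment> \<open>The appended 1 is never counted, since \<open>x < 1\<close>.\<close>
    have "length (filter (\<lambda>y. y \<le> x) (\<sigma> @ [1])) \<le> length (filter (\<lambda>y. y \<le> x) \<theta>)"
    proof (rule length_filter_le_mono)
      fix i assume "i < length (filter (\<lambda>y. y \<le> x) (\<sigma> @ [1]))"
      then have "i < ?r" using length_filter_le[of "\<lambda>y. y \<le> x" "\<sigma> @ [1]"] 1 by simp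
      then show "i < ?r \<and> sort \<theta> ! i \<le> sort (\<sigma> @ [1]) ! i"
        using assms(1) 1 by (auto simp: dominated_def Let_def intro: less_imp_le)
    qed
    then show ?thesis using 1 assms(3) by simp
  next
    case 2
    have "length (filter (\<lambda>y. y \<le> x) \<sigma>) \<le> length (filter (\<lambda>y. y \<le> x) \<theta>)"
    proof (rule length_filter_le_mono)
      fix i assume "i < length (filter (\<lambda>y. y \<le> x) \<sigma>)"
      then have "i < ?r" using length_filter_le[of "\<lambda>y. y \<le> x" \<sigma>] 2 by linarith
      then show "i < ?r \<and> sort \<theta> ! i \<le> sort \<sigma> ! i"
        using assms(1) 2 by (auto simp: dominated_def Let_def intro: less_imp_le)
    qed
    moreover have "real ?s - real ?r = 1" using 2 by simp
    ultimately show ?thesis using assms(2) by simp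
  next
    case 3
    define d where "d = ?s - ?r"
    have d: "d > 1" "length \<sigma> + 1 = ?r + d" using 3 by (auto simp: d_def)
    let ?\<theta> = "map (\<lambda>i. real i / real d) [1..<d] @ \<theta>"
    have len: "length ?\<theta> = length \<sigma>" using d by simp
    have "length (filter (\<lambda>y. y \<le> x) \<sigma>) \<le> length (filter (\<lambda>y. y \<le> x) ?\<theta>)"
    proof (rule length_filter_le_mono)
      fix i assume "i < length (filter (\<lambda>y. y \<le> x) \<sigma>)"
      then have i: "i < length \<sigma>" using length_filter_le[of "\<lambda>y. y \<le> x" \<sigma>] by linarith
      then have "fst (merged d \<theta> ! i) \<le> sort \<sigma> ! i"
        using assms(1) 3
        by (auto simp: dominated_def Let_def d_def case_prod_beta split: if_splits)
      moreover have "length (merged d \<theta>) = length \<sigma>"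
        using arg_cong[OF map_fst_merged[of d \<theta>], of length] len by simp
      ultimately show "i < length ?\<theta> \<and> sort ?\<theta> ! i \<le> sort \<sigma> ! i"
        using i len unfolding map_fst_merged[symmetric] by simp
    qed
    then have "real (length (filter (\<lambda>y. y \<le> x) \<sigma>)) \<le> real (length (filter (\<lambda>y. y \<le> x) \<theta>))
        + real (length (filter (\<lambda>y. y \<le> x) (map (\<lambda>i. real i / real d) [1..<d])))"
      by (simp only: filter_append length_append flip: of_nat_add)
    also note length_filter_fractions_le[OF assms(2), of d]
    finally show ?thesis using d(2) by (simp add: of_nat_diff d_def algebra_simps) 
  qed
qed

section \<open>Counting residues and prime powers\<close>

lemma card_residue_less:
  assumes "R < (m::nat)"
  shows "card {i. i < j \<and> i mod m = R} = j div m + (if R < j mod m then 1 else 0)"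
proof (induction j)
  case (Suc j)
  have "{i. i < Suc j \<and> i mod m = R}
      = (if j mod m = R then insert j {i. i < j \<and> i mod m = R} else {i. i < j \<and> i mod m = R})"
    by (auto simp: less_Suc_eq)
  then have "card {i. i < Suc j \<and> i mod m = R}
      = (if j mod m = R then 1 else 0) + card {i. i < j \<and> i mod m = R}" by simp
  then show ?case using Suc assms by (auto simp: div_Suc mod_Suc)
qed simp

text \<open>No power beyond p^K can divide n. A cutoff \<open>K\<close> that serves many n at once
  is what later permits exchanging the sums over i and k.\<close>

lemma multiplicity_eq_card:
  assumes "prime (p::nat)" and "0 < n" and "n < p ^ K"
  shows "multiplicity p n = card {k \<in> {1..K}. p ^ k dvd n}"
proof -
  have "p ^ k dvd n \<longleftrightarrow> k \<le> multiplicity p n" for k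
    using assms by (intro power_dvd_iff_le_multiplicity) auto
  moreover have "multiplicity p n \<le> K"
  proof (rule ccontr)
    assume "\<not> ?thesis"
    then have "p ^ K dvd n" by (simp add: multiplicity_dvd')
    then show False using assms by (auto dest: dvd_imp_le)
  qed
  ultimately have "{k \<in> {1..K}. p ^ k dvd n} = {1..multiplicity p n}"
    by (auto simp only: atLeastAtMost_iff mem_Collect_eq intro: order_trans)
  then show ?thesis by simp
qed

text \<open>For x = p the bound is the valuation of \<pi>, here compared with its truncated
  geometric series.\<close>

lemma sum_inverse_powers_le:
  assumes "1 < (x::real)"
  shows "(\<Sum>k=1..K. 1 / x ^ k) \<le> 1 / (x - 1)"
proof -
  have "(x - 1) * (\<Sum>k=1..K. 1 / x ^ k) = 1 - 1 / x ^ K"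
    using assms by (induction K) (auto simp: field_simps)
  also have "\<dots> \<le> 1" using assms by simp
  finally show ?thesis using assms by (simp add: field_simps)
qed

section \<open>The valuation as a real number, and its values on natural numbers\<close>

context padic_algebraic_closure
begin

text \<open>Real values allow subtraction and finite sums without infinities. At 0 the infinite
  value becomes the default 0, so arguments are kept nonzero below.\<close>

definition val :: "'a \<Rightarrow> real" where
  "val x = real_of_ereal (v x)"

lemma v_one: "v 1 = 0"
  using val_mult[of "of_nat p" 1] val_p by (cases "v 1") (auto simp: one_ereal_def zero_ereal_def)

text \<open>The values of x and its inverse add up to 0, which excludes both infinities.\<close>

lemma v_eq_val:
  assumes "x \<noteq> 0"
  shows "v x = ereal (val x)"
proof -
  have "v x + v (inverse x) = 0" using val_mult[of x "inverse x"] v_one assms by simp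
  then show ?thesis
    using assms val_eq_infinity_iff by (cases "v x"; cases "v (inverse x)") (auto simp: val_def)
qed

lemma val_times: "x \<noteq> 0 \<Longrightarrow> y \<noteq> 0 \<Longrightarrow> val (x * y) = val x + val y"
  using val_mult[of x y] by (simp add: v_eq_val)

lemma val_1: "val 1 = 0"
  using v_one by (simp add: val_def)

lemma val_p_nat: "val (of_nat p) = 1"
  using val_p by (simp add: val_def)

lemma val_power: "x \<noteq> 0 \<Longrightarrow> val (x ^ n) = real n * val x"
  by (induction n) (simp_all add: val_1 val_times algebra_simps)

lemma val_divide: "x \<noteq> 0 \<Longrightarrow> y \<noteq> 0 \<Longrightarrow> val (x / y) = val x - val y"
  using val_times[of "x / y" y] by simp

lemma val_uminus: "x \<noteq> 0 \<Longrightarrow> val (- x) = val x"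
  using val_times[of "-1" "-1"] val_times[of "-1" x] by (simp add: val_1)

lemma val_prod:
  assumes "finite A" and "\<And>i. i \<in> A \<Longrightarrow> f i \<noteq> 0"
  shows "val (prod f A) = (\<Sum>i\<in>A. val (f i))"
  using assms by (induction A rule: finite_induct) (auto simp: val_1 val_times)

lemma v_of_nat_nonneg: "0 \<le> v (of_nat n)"
proof (induction n)
  case 0
  then show ?case using val_eq_infinity_iff[of 0] by simp
next
  case (Suc n)
  then show ?case using val_add[of 1 "of_nat n"] v_one by simp
qed

text \<open>If n had positive valuation, a Bezout relation n a = p b + 1 would give 1 positive
  valuation. This identifies the valuation on natural numbers with the p-adic one, starting from the
  value at p.\<close>

lemma val_of_nat_coprime:
  assumes "\<not> p dvd n"
  shows "val (of_nat n) = 0"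
proof (rule ccontr)
  assume "val (of_nat n) \<noteq> 0"
  moreover have "n \<noteq> 0" using assms by (metis dvd_0_right)
  ultimately have n: "0 < v (of_nat n)" using v_of_nat_nonneg[of n] by (simp add: v_eq_val)
  have "coprime n p" using prime_imp_coprime[OF prime_p assms] by (metis coprime_commute)
  then obtain a b where ab: "n * a = p * b + 1"
    using coprime_bezout_strong[of n p] prime_p by (auto simp: prime_nat_iff)
  have "(of_nat n * of_nat a :: 'a) = of_nat p * of_nat b + 1"
    using arg_cong[OF ab, of "of_nat :: nat \<Rightarrow> 'a"] by simp
  then have "1 = of_nat n * of_nat a + (- 1) * (of_nat p * of_nat b :: 'a)" by simp
  then have "v 1 \<ge> min (v (of_nat n * of_nat a)) (v ((- 1) * (of_nat p * of_nat b)))"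
    using val_add by metis
  moreover have "0 < v (of_nat n * of_nat a)"
    unfolding val_mult using n v_of_nat_nonneg[of a] by (simp add: add_pos_nonneg)
  moreover have "0 < v ((- 1) * (of_nat p * of_nat b))"
  proof -
    have "v (- 1) = 0" using val_uminus[of 1] by (simp add: val_1 v_eq_val)
    then show ?thesis
      unfolding val_mult using v_of_nat_nonneg[of b] val_p by (simp add: add_pos_nonneg)
  qed
  ultimately show False using v_one by (simp add: min_def split: if_splits)
qed

lemma val_of_nat:
  assumes "0 < n"
  shows "val (of_nat n) = multiplicity p n"
proof -
  obtain q where q: "n = p ^ multiplicity p n * q" "\<not> p dvd q"
    using multiplicity_decompose'[of n p] assms prime_p by (auto simp: prime_nat_iff)
  have "q \<noteq> 0" "p \<noteq> 0" using q(2) prime_p by (auto intro: gr0I)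
  then have "val (of_nat (p ^ multiplicity p n * q)) = multiplicity p n"
    by (simp add: val_times val_power val_p_nat val_of_nat_coprime[OF q(2)])
  then show ?thesis using q(1) by simp
qed

section \<open>Valuations of Pochhammer symbols of p-integral rationals\<close>

lemma p_integral_rat_period:
  assumes "p_integral v (of_rat \<alpha>)" and "0 < \<alpha>"
  shows "\<exists>a>0. (of_nat p ^ a - 1) * \<alpha> \<in> \<nat>"
proof -
  obtain c b where cb: "\<alpha> = Rat.Fract c b" "0 < b" "coprime c b" by (cases \<alpha>)
  then have "0 < c" using assms(2) by (simp add: Rat.zero_less_Fract_iff)
  define m n where "m = nat c" and "n = nat b"
  have mn: "0 < m" "0 < n" "c = int m" "b = int n"
    using cb \<open>0 < c\<close> by (auto simp: m_def n_def)
  then have "coprime m n" using cb(3) by simp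
  have \<alpha>: "\<alpha> = of_nat m / of_nat n" using mn cb(1) by (simp add: Fract_of_int_quotient)
  \<comment> \<open>A factor p of the denominator would be absent from the numerator in lowest terms
    and make the valuation negative.\<close>
  have "\<not> p dvd n"
  proof
    assume "p dvd n"
    then have "\<not> p dvd m" using \<open>coprime m n\<close> prime_p by (metis coprime_common_divisor not_prime_unit)
    then have "val (of_nat m) = 0" by (rule val_of_nat_coprime)
    moreover have "0 < multiplicity p n"
      using \<open>p dvd n\<close> mn(2) prime_p by (simp add: prime_multiplicity_gt_zero_iff)
    ultimately have "val (of_nat m / of_nat n) < 0"
      using mn by (simp add: val_divide val_of_nat)
    then show False
      using assms(1) mn by (simp add: p_integral_def \<alpha> of_rat_divide v_eq_val)
  qed
  then have "coprime p n" using prime_p by (simp add: prime_imp_coprime)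
  \<comment> \<open>Euler's theorem supplies a period, namely the totient of the
    denominator.\<close>
  then have "n dvd p ^ totient n - 1" by (intro cong_to_1_nat euler_theorem)
  then obtain e where "p ^ totient n - 1 = n * e" by blast
  then have "(of_nat (p ^ totient n - 1) :: rat) = of_nat n * of_nat e" by simp
  moreover have "1 \<le> p ^ totient n" using prime_p by (simp add: Suc_leI prime_gt_0_nat)
  ultimately have "(of_nat p ^ totient n - 1 :: rat) = of_nat n * of_nat e"
    by (simp add: of_nat_diff)
  then have "(of_nat p ^ totient n - 1) * \<alpha> = of_nat (e * m)" using mn(2) \<alpha> by simp
  then show ?thesis using mn(2) by (intro exI[of _ "totient n"]) (metis of_nat_in_Nats totient_gt_0_iff)
qed

text \<open>Since \<open>D\<close> is a p-adic unit, \<alpha> + i has the valuation of t + D i. This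
  is the number of k \<ge> 1 with p^k dividing t + D i, that is, with i congruent to
  \<open>R k\<close>; summing over i < j first counts a residue class.\<close>

lemma val_pochhammer:
  assumes "coprime D p" and "0 < t" and "of_nat D * \<alpha> = of_nat t"
    and R: "\<And>k. R k < p ^ k" "\<And>k. p ^ k dvd t + D * R k"
  shows "pochhammer \<alpha> j \<noteq> 0 \<and> (\<forall>\<^sub>F K in sequentially. val (pochhammer \<alpha> j) =
    (\<Sum>k=1..K. real (j div p ^ k) + (if R k < j mod p ^ k then 1 else 0)))"
proof -
  have p1: "1 < p" using prime_p by (rule prime_gt_1_nat)
  have D0: "D \<noteq> 0" using assms(1) p1 by (auto intro: gr0I)
  define n where "n i = t + D * i" for i
  have n0: "0 < n i" for i using assms(2) by (simp add: n_def)
  have \<alpha>i: "\<alpha> + of_nat i = of_nat (n i) / of_nat D" for i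
    using D0 by (simp add: n_def field_simps flip: assms(3))
  have nz: "\<alpha> + of_nat i \<noteq> 0" for i
    unfolding \<alpha>i using n0[of i] D0 by (simp del: of_nat_add add: gr0_implies_Suc)
  have "\<not> p dvd D" 
    using assms(1) prime_p by (metis coprime_common_divisor dvd_refl not_prime_unit)
  then have val_i: "val (\<alpha> + of_nat i) = multiplicity p (n i)" for i
    unfolding \<alpha>i using n0[of i] D0 by (simp add: val_divide val_of_nat not_dvd_imp_multiplicity_0)
  have poch: "pochhammer \<alpha> j = (\<Prod>i<j. \<alpha> + of_nat i)"
    by (simp add: pochhammer_prod lessThan_atLeast0)
  have dvd_iff: "p ^ k dvd n i \<longleftrightarrow> i mod p ^ k = R k" for i k
  proof -
    have "[n (R k) = 0] (mod p ^ k)" using R(2)[of k] by (simp add: cong_0_iff n_def)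
    then have "p ^ k dvd n i \<longleftrightarrow> [n i = n (R k)] (mod p ^ k)"
      by (metis cong_0_iff cong_sym cong_trans)
    \<comment> \<open>\<open>D\<close> is invertible modulo p^k and can be cancelled.\<close>
    also have "\<dots> \<longleftrightarrow> [i = R k] (mod p ^ k)"
      using assms(1) unfolding n_def cong_add_lcancel_nat
      by (intro cong_mult_lcancel_nat) simp
    finally show ?thesis using R(1)[of k] by (simp add: cong_def)
  qed
  have "val (pochhammer \<alpha> j) =
      (\<Sum>k=1..K. real (j div p ^ k) + (if R k < j mod p ^ k then 1 else 0))"
    \<comment> \<open>This cutoff works for all i < j simultaneously, since n i \<le> n j < p^(n
      j).\<close>
    if K: "K \<ge> n j" for K
  proof -
    have "multiplicity p (n i) = (\<Sum>k=1..K. if i mod p ^ k = R k then 1 else 0)" if "i < j" for i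
    proof -
      have "n i \<le> n j" using that by (simp add: n_def)
      also have "\<dots> < p ^ n j" using p1 by (simp add: power_gt_expt)
      also have "\<dots> \<le> p ^ K" using p1 K by (intro power_increasing) auto
      finally have "multiplicity p (n i) = card {k \<in> {1..K}. p ^ k dvd n i}"
        by (intro multiplicity_eq_card[OF prime_p n0])
      then show ?thesis by (simp add: dvd_iff sum.If_cases Int_def)
    qed
    then have "(\<Sum>i<j. multiplicity p (n i)) = (\<Sum>i<j. \<Sum>k=1..K. if i mod p ^ k = R k then 1 else 0)"
      by simp
    also have "\<dots> = (\<Sum>k=1..K. \<Sum>i<j. if i mod p ^ k = R k then 1 else 0)" by (rule sum.swap)
    also have "\<dots> = (\<Sum>k=1..K. j div p ^ k + (if R k < j mod p ^ k then 1 else 0))"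
      by (intro sum.cong refl)
        (simp add: sum.If_cases Int_def flip: card_residue_less[OF R(1)])
    finally have "real (\<Sum>i<j. multiplicity p (n i)) =
        real (\<Sum>k=1..K. j div p ^ k + (if R k < j mod p ^ k then 1 else 0))" by (rule arg_cong)
    moreover have "val (pochhammer \<alpha> j) = real (\<Sum>i<j. multiplicity p (n i))"
      unfolding poch by (simp add: val_prod nz val_i)
    ultimately show ?thesis by (simp only: of_nat_sum of_nat_add if_distrib of_nat_1 of_nat_0)
  qed
  then show ?thesis by (auto simp: poch nz eventually_sequentially)
qed

text \<open>Legendre's formula, as the case \<alpha> = 1: the residue of -1 is p^k - 1, which no
  remainder modulo p^k exceeds, so the extra term vanishes.\<close>

lemma val_fact:
  "\<forall>\<^sub>F K in sequentially. val (fact j) = (\<Sum>k=1..K. real (j div p ^ k))"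
proof -
  have p0: "0 < p" using prime_p by (rule prime_gt_0_nat)
  have "\<not> p ^ k - 1 < j mod p ^ k" for k
    using mod_less_divisor[OF zero_less_power[OF p0, of k], of j] by linarith
  then show ?thesis
    using val_pochhammer[of 1 1 1 "\<lambda>k. p ^ k - 1" j] p0 by (simp add: pochhammer_fact)
qed

text \<open>Because 0 < \<alpha> \<le> 1, the integer condition R < m is the same as \<alpha> + R
  \<le> m. Division by p^k turns it into \<alpha>^(k) \<le> m/p^k, the form to which domination
  applies.\<close>

lemma val_pochhammer_rat:
  assumes "p_integral v (of_rat \<alpha>)" and "0 < \<alpha>" and "\<alpha> \<le> 1"
  shows "pochhammer (of_rat \<alpha>) j \<noteq> (0::'a)"
    and "\<forall>\<^sub>F K in sequentially. val (pochhammer (of_rat \<alpha>) j) = (\<Sum>k=1..K. real (j div p ^ k) +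
      (if real_of_rat (frac_shift p k \<alpha>) \<le> real (j mod p ^ k) / real (p ^ k) then 1 else 0))"
proof -
  have p2: "2 \<le> p" using prime_p by (rule prime_ge_2_nat)
  obtain D t where Dt: "coprime D p" "0 < t" "of_nat D * \<alpha> = of_nat t"
    and "\<And>k. \<exists>R<p ^ k. of_nat p ^ k * frac_shift p k \<alpha> = \<alpha> + of_nat R \<and> p ^ k dvd t + D * R"
    using frac_shift_residue[OF p2 assms(2,3) p_integral_rat_period[OF assms(1,2)]] by blast
  then obtain R where R: "\<And>k. R k < p ^ k" "\<And>k. p ^ k dvd t + D * R k"
    and shift: "\<And>k. of_nat p ^ k * frac_shift p k \<alpha> = \<alpha> + of_nat (R k)"
    by metis
  have "of_nat D * of_rat \<alpha> = (of_nat t :: 'a)"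
    using arg_cong[OF Dt(3), of "of_rat :: rat \<Rightarrow> 'a"] by (simp add: of_rat_mult)
  note * = val_pochhammer[OF Dt(1,2) this R]
  have "R k < m \<longleftrightarrow> real_of_rat (frac_shift p k \<alpha>) \<le> real m / real (p ^ k)" for k m
  proof -
    have "R k < m \<longleftrightarrow> \<alpha> + of_nat (R k) \<le> of_nat m"
    proof
      assume "R k < m"
      then have "of_nat (Suc (R k)) \<le> (of_nat m :: rat)" by (simp only: of_nat_le_iff Suc_leI)
      then show "\<alpha> + of_nat (R k) \<le> of_nat m" using assms(3) by simp
    next
      assume "\<alpha> + of_nat (R k) \<le> of_nat m"
      then have "of_nat (R k) < (of_nat m :: rat)" using assms(2) by linarith
      then show "R k < m" by simp
    qed
    also have "\<dots> \<longleftrightarrow> frac_shift p k \<alpha> \<le> of_nat m / of_nat (p ^ k)"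
      using p2 by (simp add: field_simps flip: shift)
    also have "\<dots> \<longleftrightarrow> real_of_rat (frac_shift p k \<alpha>) \<le> real_of_rat (of_nat m / of_nat (p ^ k))"
      by (rule of_rat_less_eq[symmetric])
    also have "real_of_rat (of_nat m / of_nat (p ^ k)) = real m / real (p ^ k)"
      by (simp add: of_rat_divide of_rat_power)
    finally show ?thesis .
  qed
  with * show "pochhammer (of_rat \<alpha>) j \<noteq> (0::'a)"
    and "\<forall>\<^sub>F K in sequentially. val (pochhammer (of_rat \<alpha>) j) = (\<Sum>k=1..K. real (j div p ^ k) +
      (if real_of_rat (frac_shift p k \<alpha>) \<le> real (j mod p ^ k) / real (p ^ k) then 1 else 0))"
    by simp_all
qed

text \<open>The fold is the shape of numerator and denominator in
  \<open>fps_hypergeo_nth_alt\<close>; the seed \<open>c\<close> will be the power of \<pi> in one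
  and the factorial in the other.\<close>

lemma val_foldr_pochhammer:
  assumes "\<forall>x\<in>set xs. p_integral v (of_rat x) \<and> 0 < x \<and> x \<le> 1" and "c \<noteq> 0"
  shows "foldr (\<lambda>a r. r * pochhammer a j) (map of_rat xs) c \<noteq> 0 \<and>
    (\<forall>\<^sub>F K in sequentially. val (foldr (\<lambda>a r. r * pochhammer a j) (map of_rat xs) c) =
      val c + (\<Sum>k=1..K. real (length xs) * real (j div p ^ k) +
        real (length (filter (\<lambda>y. y \<le> real (j mod p ^ k) / real (p ^ k))
          (map (\<lambda>x. real_of_rat (frac_shift p k x)) xs)))))"
  using assms(1)
proof (induction xs)
  case Nil
  then show ?case using assms(2) by simp
next
  case (Cons x xs)
  have x: "p_integral v (of_rat x)" "0 < x" "x \<le> 1" using Cons.prems by auto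
  have "\<forall>x\<in>set xs. p_integral v (of_rat x) \<and> 0 < x \<and> x \<le> 1"
    using Cons.prems by simp
  note IH = Cons.IH[OF this]
  show ?case
  proof (intro conjI)
    show "foldr (\<lambda>a r. r * pochhammer a j) (map of_rat (x # xs)) c \<noteq> 0"
      using IH val_pochhammer_rat(1)[OF x] by simp
    show "\<forall>\<^sub>F K in sequentially. val (foldr (\<lambda>a r. r * pochhammer a j) (map of_rat (x # xs)) c) =
      val c + (\<Sum>k=1..K. real (length (x # xs)) * real (j div p ^ k) +
        real (length (filter (\<lambda>y. y \<le> real (j mod p ^ k) / real (p ^ k))
          (map (\<lambda>x. real_of_rat (frac_shift p k x)) (x # xs)))))"
      using conjunct2[OF IH] val_pochhammer_rat(2)[OF x, of j]
    proof eventually_elim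
      case (elim K)
      show ?case
        using IH val_pochhammer_rat(1)[OF x, of j]
        by (simp add: val_times elim flip: sum.distrib)
          (intro sum.cong refl, simp add: algebra_simps)
    qed
  qed
qed

end

section \<open>Nonnegative valuation of every coefficient\<close>

theorem proposition4p7:
  fixes p r s :: nat
    and v :: "'a::{alg_closed_field, field_char_0} \<Rightarrow> ereal"
    and \<pi> :: 'a
    and \<theta> \<sigma> :: "rat list"
  assumes "prime p"
    and "padic_algebraic_closure p v"
    and "\<pi> ^ (p - 1) = - of_nat p"
    and "length \<theta> = r" and "length \<sigma> + 1 = s" and "r \<le> s"
    and "\<forall>x \<in> set \<theta> \<union> set \<sigma>. p_integral v (of_rat x) \<and> 0 < x \<and> x \<le> 1"
    and "\<forall>k. dominated (map (\<lambda>x. real_of_rat (frac_shift p k x)) \<theta>)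
                       (map (\<lambda>x. real_of_rat (frac_shift p k x)) \<sigma>)"
  shows "\<forall>j. p_integral v
    (fps_nth (fps_hypergeo (map of_rat \<theta>) (map of_rat \<sigma>) (\<pi> ^ (s - r))) j)"
proof
  fix j
  interpret padic_algebraic_closure p v by fact
  have p1: "1 < p" using \<open>prime p\<close> by (rule prime_gt_1_nat)
  have \<pi>0: "\<pi> \<noteq> 0" using assms(3) p1 by (auto simp: power_0_left split: if_splits)
  have "val (\<pi> ^ (p - 1)) = 1"
    unfolding assms(3) using p1 by (simp add: val_uminus val_p_nat)
  then have "real (p - 1) * val \<pi> = 1" by (simp only: val_power[OF \<pi>0])
  then have val_\<pi>: "val \<pi> = 1 / (real p - 1)" using p1 by (simp add: field_simps of_nat_diff)
  let ?c = "(\<pi> ^ (s - r)) ^ j"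
  let ?shift = "\<lambda>k. map (\<lambda>x. real_of_rat (frac_shift p k x))"
  define N where "N = foldr (\<lambda>a r. r * pochhammer a j) (map of_rat \<theta>) ?c"
  define M :: 'a where "M = foldr (\<lambda>a r. r * pochhammer a j) (map of_rat \<sigma>) (fact j)"
  define x where "x k = real (j mod p ^ k) / real (p ^ k)" for k
  define count where "count k xs = real (length (filter (\<lambda>y. y \<le> x k) (?shift k xs)))" for k xs
  have N: "N \<noteq> 0" "\<forall>\<^sub>F K in sequentially. val N =
      val ?c + (\<Sum>k=1..K. real r * real (j div p ^ k) + count k \<theta>)"
    using val_foldr_pochhammer[of \<theta> ?c j] assms(4,7) \<pi>0
    by (simp_all add: N_def count_def x_def)
  have M: "M \<noteq> 0" "\<forall>\<^sub>F K in sequentially. val M =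
      val (fact j) + (\<Sum>k=1..K. real (length \<sigma>) * real (j div p ^ k) + count k \<sigma>)"
    using val_foldr_pochhammer[of \<sigma> "fact j" j] assms(7)
    by (simp_all add: M_def count_def x_def)
  \<comment> \<open>The three expansions hold together for all large \<open>K\<close>, so they can
    be compared term by term with one cutoff.\<close>
  have "\<forall>\<^sub>F K in sequentially. 0 \<le> val N - val M"
    using N(2) M(2) val_fact[of j]
  proof eventually_elim
    case (elim K)
    have "real (s - r) * real j * (\<Sum>k=1..K. 1 / real p ^ k) \<le> real (s - r) * real j * (1 / (real p - 1))"
      using p1 by (intro mult_left_mono sum_inverse_powers_le) auto
    also have "\<dots> = val ?c" using \<pi>0 by (simp add: val_power val_\<pi>)
    finally have c: "(\<Sum>k=1..K. real (s - r) * (real j / real p ^ k)) \<le> val ?c"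
      by (simp add: sum_distrib_left)
    \<comment> \<open>Splitting j/p^k into integer part and \<open>x k\<close>, the integer part has
      total coefficient (s - r) + r - 1 - (s - 1) = 0. What remains is the inequality of
      \<open>dominated_count\<close>.\<close>
    have term_nonneg: "0 \<le> real (s - r) * (real j / real p ^ k)
        + (real r * real (j div p ^ k) + count k \<theta>)
        - (real (j div p ^ k) + (real (length \<sigma>) * real (j div p ^ k) + count k \<sigma>))" for k
    proof -
      have x01: "0 \<le> x k" "x k < 1" using p1 by (auto simp: x_def)
      have "real j = real (j div p ^ k) * real (p ^ k) + real (j mod p ^ k)"
        by (metis div_mult_mod_eq of_nat_add of_nat_mult)
      then have j: "real j / real p ^ k = real (j div p ^ k) + x k"
        using p1 by (simp add: x_def field_simps)
      have len: "real (length \<sigma>) = real r + real (s - r) - 1"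
        using assms(5,6) by simp
      have "count k \<sigma> \<le> count k \<theta> + real (s - r) * x k"
        using dominated_count[OF assms(8)[rule_format] x01, of k] assms(4)
        by (simp add: count_def len)
      then show ?thesis unfolding j len by (simp add: algebra_simps)
    qed
    have "0 \<le> (\<Sum>k=1..K. real (s - r) * (real j / real p ^ k)
        + (real r * real (j div p ^ k) + count k \<theta>)
        - (real (j div p ^ k) + (real (length \<sigma>) * real (j div p ^ k) + count k \<sigma>)))"
      by (intro sum_nonneg term_nonneg)
    then show ?case using c unfolding elim by (simp add: sum.distrib sum_subtractf)
  qed
  \<comment> \<open>The inequality does not involve \<open>K\<close>, so holding eventually means
    holding.\<close>
  then have "0 \<le> val N - val M" by (simp add: eventually_const_iff)
  then have "0 \<le> v (N / M)" using N(1) M(1) by (simp add: v_eq_val val_divide)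
  then show "p_integral v
      (fps_nth (fps_hypergeo (map of_rat \<theta>) (map of_rat \<sigma>) (\<pi> ^ (s - r))) j)"
    unfolding p_integral_def fps_hypergeo_nth_alt N_def M_def by simp
qed

end
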